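(* Let $(\mathcal{X},\mathcal{A},\mathcal{P})$ be a statistical model with $\mathcal{P}=\{P_\theta,\ \theta\in\Theta\}$. If $\widehat{\mathcal{A}}_1,\widehat{\mathcal{A}}_2\subset\mathcal{A}$ are MVE-algebras for this model, then $\widehat{\mathcal{A}}=\sigma(\widehat{\mathcal{A}}_1,\widehat{\mathcal{A}}_2)$, the smallest $\sigma$-algebra containing both $\widehat{\mathcal{A}}_1$ and $\widehat{\mathcal{A}}_2$, is also an MVE-algebra for this model.
   Context: A statistical model $(\mathcal{X},\mathcal{A},\mathcal{P})$ consists of a measurable space $(\mathcal{X},\mathcal{A})$ and a family $\mathcal{P}=\{P_\theta,\ \theta\in\Theta\}$ of probability measures on it, indexed by an arbitrary parameter set $\Theta$; $X$ denotes a random element of $(\mathcal{X},\mathcal{A})$ with distribution $P_\theta$, and $E_\theta$, $\mathrm{Var}_\theta$ denote expectation and variance under $P_\theta$. A statistic is a real-valued $\mathcal{A}$-measurable function of $X$; it has finite second moment if $E_\theta|\widehat g(X)|^2<\infty$ for all $\theta\in\Theta$. A statistic $\widehat g(X)$ with finite second moment is called a UMVUE (uniformly minimum variance unbiased estimator, of $g(\theta)=E_\theta\widehat g(X)$) if $\mathrm{Var}_\theta(\widehat g(X))\le \mathrm{Var}_\theta(\widetilde g(X))$ for all $\theta\in\Theta$, for every statistic $\widetilde g(X)$ with finite second moment satisfying $E_\theta\widetilde g(X)=E_\theta\widehat g(X)$ for all $\theta\in\Theta$. A subalgebra means a sub-$\sigma$-algebra of $\mathcal{A}$. A subalgebra $\widehat{\mathcal{A}}\subset\mathcal{A}$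 is an MVE-algebra if every $\widehat{\mathcal{A}}$-measurable statistic with finite second moment is a UMVUE. *)

theory Defs
  imports "HOL-Probability.Probability"
begin

(* The measure M only carries the measurable space (space M, sets M);
   its emeasure is irrelevant. The same holds for the measures F below,
   which represent sub-sigma-algebras. *)

definition statistical_model :: "'a measure \<Rightarrow> ('t \<Rightarrow> 'a measure) \<Rightarrow> 't set \<Rightarrow> bool" where
  "statistical_model M P \<Theta> \<longleftrightarrow> (\<forall>\<theta>\<in>\<Theta>. prob_space (P \<theta>) \<and> sets (P \<theta>) = sets M)"

definition finite_second_moment :: "('t \<Rightarrow> 'a measure) \<Rightarrow> 't set \<Rightarrow> ('a \<Rightarrow> real) \<Rightarrow> bool" where
  "finite_second_moment P \<Theta> g \<longleftrightarrow> (\<forall>\<theta>\<in>\<Theta>. integrable (P \<theta>) (\<lambda>x. \<bar>g x\<bar>\<^sup>2))"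

definition UMVUE :: "'a measure \<Rightarrow> ('t \<Rightarrow> 'a measure) \<Rightarrow> 't set \<Rightarrow> ('a \<Rightarrow> real) \<Rightarrow> bool" where
  "UMVUE M P \<Theta> g \<longleftrightarrow>
     g \<in> borel_measurable M \<and> finite_second_moment P \<Theta> g \<and>
     (\<forall>h \<in> borel_measurable M.
        finite_second_moment P \<Theta> h \<and>
        (\<forall>\<theta>\<in>\<Theta>. prob_space.expectation (P \<theta>) h = prob_space.expectation (P \<theta>) g) \<longrightarrow>
        (\<forall>\<theta>\<in>\<Theta>. prob_space.variance (P \<theta>) g \<le> prob_space.variance (P \<theta>) h))"

definition MVE_algebra :: "'a measure \<Rightarrow> ('t \<Rightarrow> 'a measure) \<Rightarrow> 't set \<Rightarrow> 'a measure \<Rightarrow> bool" where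
  "MVE_algebra M P \<Theta> F \<longleftrightarrow>
     subalgebra M F \<and>
     (\<forall>g \<in> borel_measurable F. finite_second_moment P \<Theta> g \<longrightarrow> UMVUE M P \<Theta> g)"

end

theory Submission
  imports Defs
begin

text \<open>
  The proof rests on the Lehmann--Scheffe orthogonality criterion: a statistic of finite second
  moment is a UMVUE iff, under every parameter, it is uncorrelated with every unbiased estimator
  of zero (lemma \<open>UMVUE_iff_orthogonal\<close>).

  The point that makes two MVE-algebras combine is that indicators of sets in an MVE-algebra act
  on the unbiased estimators of zero. If \<open>A\<close> lies in an MVE-algebra and \<open>U\<close> is an
  unbiased estimator of zero, then the indicator of \<open>A\<close> is a UMVUE, so
  \<open>1\<^sub>A U\<close> has mean zero under \<^emph>\<open>every\<close> parameter: it is again an unbiased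
  estimator of zero (lemma \<open>MVE_algebra_indicator_mult\<close>). Hence this can be done twice, first
  with a set \<open>A\<close> of one MVE-algebra and then with a set \<open>B\<close> of the other, and the
  integral of \<open>U\<close> over \<open>A \<inter> B\<close> vanishes. These intersections are stable under
  intersection and generate the joined sigma-algebra, so by Dynkin's theorem the integral of \<open>U\<close>
  vanishes over each of its sets. In other words the conditional expectation of \<open>U\<close> given
  the joined sigma-algebra is zero, so \<open>U\<close> is orthogonal to every square integrable statistic
  measurable there, and the criterion, read backwards, finishes the proof.
\<close>

section \<open>Square integrable functions on a probability space\<close>

lemma integrable_mult_of_squares:
  fixes f g :: "'a \<Rightarrow> real"
  assumes [measurable]: "f \<in> borel_measurable N" "g \<in> borel_measurable N"
    and "integrable N (\<lambda>x. (f x)\<^sup>2)" "integrable N (\<lambda>x. (g x)\<^sup>2)"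
  shows "integrable N (\<lambda>x. f x * g x)"
proof (rule Bochner_Integration.integrable_bound)
  show "integrable N (\<lambda>x. (f x)\<^sup>2 + (g x)\<^sup>2)"
    using assms by simp
  have "\<bar>a * b\<bar> \<le> a\<^sup>2 + b\<^sup>2" for a b :: real
  proof -
    have "2 * (\<bar>a\<bar> * \<bar>b\<bar>) \<le> a\<^sup>2 + b\<^sup>2"
      using sum_squares_bound[of "\<bar>a\<bar>" "\<bar>b\<bar>"] by (simp add: mult.assoc)
    moreover have "0 \<le> \<bar>a\<bar> * \<bar>b\<bar>"
      by simp
    ultimately show ?thesis
      unfolding abs_mult by linarith
  qed
  then show "AE x in N. norm (f x * g x) \<le> norm ((f x)\<^sup>2 + (g x)\<^sup>2)"
    by simp
qed simp

text \<open>The variance along a line of estimators with a common mean is a quadratic polynomial, whose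
  linear coefficient is the covariance with the direction.\<close>

lemma (in prob_space) variance_add_mean_zero:
  fixes g U :: "'a \<Rightarrow> real"
  assumes [measurable]: "g \<in> borel_measurable M" "U \<in> borel_measurable M"
    and sq: "integrable M (\<lambda>x. (g x)\<^sup>2)" "integrable M (\<lambda>x. (U x)\<^sup>2)"
    and zero: "expectation U = 0"
  shows "expectation (\<lambda>x. g x + t * U x) = expectation g"
    and "variance (\<lambda>x. g x + t * U x) =
      variance g + 2 * t * expectation (\<lambda>x. g x * U x) + t\<^sup>2 * expectation (\<lambda>x. (U x)\<^sup>2)"
proof -
  have int: "integrable M g" "integrable M U" "integrable M (\<lambda>x. g x * U x)"
    using sq by (auto intro: square_integrable_imp_integrable integrable_mult_of_squares)
  show mean: "expectation (\<lambda>x. g x + t * U x) = expectation g"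
    using int zero by simp
  have expand: "(\<lambda>x. (g x + t * U x)\<^sup>2) =
      (\<lambda>x. (g x)\<^sup>2 + 2 * t * (g x * U x) + t\<^sup>2 * (U x)\<^sup>2)"
    by (auto simp: power2_eq_square algebra_simps)
  have "variance (\<lambda>x. g x + t * U x) =
      expectation (\<lambda>x. (g x + t * U x)\<^sup>2) - (expectation g)\<^sup>2"
    using int sq by (subst variance_eq) (auto simp: expand zero)
  also have "expectation (\<lambda>x. (g x + t * U x)\<^sup>2) = expectation (\<lambda>x. (g x)\<^sup>2)
      + 2 * t * expectation (\<lambda>x. g x * U x) + t\<^sup>2 * expectation (\<lambda>x. (U x)\<^sup>2)"
    unfolding expand using int sq by simp
  finally show "variance (\<lambda>x. g x + t * U x) =
      variance g + 2 * t * expectation (\<lambda>x. g x * U x) + t\<^sup>2 * expectation (\<lambda>x. (U x)\<^sup>2)"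
    using int sq by (simp add: variance_eq)
qed

lemma linear_coeff_zero_if_quadratic_nonneg:
  fixes b c :: real
  assumes "\<And>t. 0 \<le> 2 * t * b + t\<^sup>2 * c" and "0 \<le> c"
  shows "b = 0"
proof (rule ccontr)
  assume "b \<noteq> 0"
  \<comment> \<open>Near the minimum \<open>- b / c\<close>; the \<open>1\<close> in the denominator covers \<open>c = 0\<close>.\<close>
  define t where "t = - b / (c + 1)"
  have "2 * t * b + t\<^sup>2 * c = - (b\<^sup>2 * (c + 2)) / (c + 1)\<^sup>2"
    using \<open>0 \<le> c\<close> unfolding t_def by (simp add: divide_simps) (simp add: power2_eq_square algebra_simps)
  also have "\<dots> < 0"
    using \<open>b \<noteq> 0\<close> \<open>0 \<le> c\<close> by simp
  finally show False
    using assms(1)[of t] by simp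
qed

section \<open>Unbiased estimators of zero and the orthogonality criterion\<close>

definition zero_estimator :: "'a measure \<Rightarrow> ('t \<Rightarrow> 'a measure) \<Rightarrow> 't set \<Rightarrow> ('a \<Rightarrow> real) \<Rightarrow> bool" where
  "zero_estimator M P \<Theta> U \<longleftrightarrow>
     U \<in> borel_measurable M \<and> finite_second_moment P \<Theta> U \<and>
     (\<forall>\<theta>\<in>\<Theta>. prob_space.expectation (P \<theta>) U = 0)"

lemma finite_second_moment_add_cmult:
  assumes model: "statistical_model M P \<Theta>"
    and gU: "g \<in> borel_measurable M" "U \<in> borel_measurable M"
    and sq: "finite_second_moment P \<Theta> g" "finite_second_moment P \<Theta> U"
  shows "finite_second_moment P \<Theta> (\<lambda>x. g x + t * U x)"
  unfolding finite_second_moment_def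
proof
  fix \<theta> assume "\<theta> \<in> \<Theta>"
  then have [measurable_cong]: "sets (P \<theta>) = sets M"
    using model by (simp add: statistical_model_def)
  have [measurable]: "g \<in> borel_measurable (P \<theta>)" "U \<in> borel_measurable (P \<theta>)"
    using gU by simp_all
  have sq': "integrable (P \<theta>) (\<lambda>x. (g x)\<^sup>2)" "integrable (P \<theta>) (\<lambda>x. (U x)\<^sup>2)"
    using sq \<open>\<theta> \<in> \<Theta>\<close> by (auto simp: finite_second_moment_def)
  have expand: "\<bar>g x + t * U x\<bar>\<^sup>2 = (g x)\<^sup>2 + 2 * t * (g x * U x) + t\<^sup>2 * (U x)\<^sup>2" for x
    by (simp add: power2_eq_square algebra_simps)
  show "integrable (P \<theta>) (\<lambda>x. \<bar>g x + t * U x\<bar>\<^sup>2)"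
    unfolding expand using sq' integrable_mult_of_squares[of g "P \<theta>" U] by simp
qed

text \<open>The competitors of \<open>g\<close> are exactly the statistics \<open>g + U\<close> with \<open>U\<close> an
  unbiased estimator of zero. As all multiples \<open>t U\<close> are allowed, minimality of \<open>g\<close> means
  that the quadratic polynomial of lemma \<open>variance_add_mean_zero\<close> is minimal at \<open>t = 0\<close>,
  that is, that its linear coefficient vanishes.\<close>

lemma UMVUE_iff_orthogonal:
  assumes model: "statistical_model M P \<Theta>"
    and g: "g \<in> borel_measurable M" "finite_second_moment P \<Theta> g"
  shows "UMVUE M P \<Theta> g \<longleftrightarrow>
    (\<forall>U. zero_estimator M P \<Theta> U \<longrightarrow> (\<forall>\<theta>\<in>\<Theta>. (LINT x|P \<theta>. g x * U x) = 0))"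
    (is "_ \<longleftrightarrow> ?orth")
proof -
  have line:
    "prob_space.expectation (P \<theta>) (\<lambda>x. g x + t * U x) = prob_space.expectation (P \<theta>) g"
    "prob_space.variance (P \<theta>) (\<lambda>x. g x + t * U x) =
      prob_space.variance (P \<theta>) g + 2 * t * (LINT x|P \<theta>. g x * U x)
      + t\<^sup>2 * (LINT x|P \<theta>. (U x)\<^sup>2)"
    if "zero_estimator M P \<Theta> U" "\<theta> \<in> \<Theta>" for U \<theta> t
  proof -
    interpret prob_space "P \<theta>"
      using model \<open>\<theta> \<in> \<Theta>\<close> by (simp add: statistical_model_def)
    have [measurable_cong]: "sets (P \<theta>) = sets M"
      using model \<open>\<theta> \<in> \<Theta>\<close> by (simp add: statistical_model_def)
    have "g \<in> borel_measurable (P \<theta>)" "U \<in> borel_measurable (P \<theta>)"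
      "integrable (P \<theta>) (\<lambda>x. (g x)\<^sup>2)" "integrable (P \<theta>) (\<lambda>x. (U x)\<^sup>2)"
      "expectation U = 0"
      using g that by (auto simp: zero_estimator_def finite_second_moment_def)
    then show
      "expectation (\<lambda>x. g x + t * U x) = expectation g"
      "variance (\<lambda>x. g x + t * U x) = variance g + 2 * t * expectation (\<lambda>x. g x * U x)
        + t\<^sup>2 * expectation (\<lambda>x. (U x)\<^sup>2)"
      by (rule variance_add_mean_zero)+
  qed
  show ?thesis
  proof
    assume umvue: "UMVUE M P \<Theta> g"
    show ?orth
    proof (intro allI impI ballI)
      fix U \<theta> assume U: "zero_estimator M P \<Theta> U" and \<theta>: "\<theta> \<in> \<Theta>"
      show "(LINT x|P \<theta>. g x * U x) = 0"
      proof (rule linear_coeff_zero_if_quadratic_nonneg)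
        fix t :: real
        have "(\<lambda>x. g x + t * U x) \<in> borel_measurable M"
          using g U by (auto simp: zero_estimator_def)
        moreover have "finite_second_moment P \<Theta> (\<lambda>x. g x + t * U x)"
          using finite_second_moment_add_cmult[OF model] g U by (simp add: zero_estimator_def)
        ultimately have "prob_space.variance (P \<theta>) g
            \<le> prob_space.variance (P \<theta>) (\<lambda>x. g x + t * U x)"
          using umvue line(1)[OF U] \<theta> unfolding UMVUE_def by blast
        then show "0 \<le> 2 * t * (LINT x|P \<theta>. g x * U x) + t\<^sup>2 * (LINT x|P \<theta>. (U x)\<^sup>2)"
          unfolding line(2)[OF U \<theta>] by simp
      qed simp
    qed
  next
    assume orth: ?orth
    show "UMVUE M P \<Theta> g"
      unfolding UMVUE_def
    proof (intro conjI ballI impI g; elim conjE)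
      fix h \<theta>
      assume h: "h \<in> borel_measurable M" "finite_second_moment P \<Theta> h"
        and mean: "\<forall>\<theta>\<in>\<Theta>. prob_space.expectation (P \<theta>) h = prob_space.expectation (P \<theta>) g"
        and \<theta>: "\<theta> \<in> \<Theta>"
      have int: "integrable (P \<theta>') f" if "f \<in> borel_measurable M" "finite_second_moment P \<Theta> f" "\<theta>' \<in> \<Theta>"
        for f \<theta>'
      proof -
        interpret prob_space "P \<theta>'"
          using model that by (simp add: statistical_model_def)
        have [measurable_cong]: "sets (P \<theta>') = sets M"
          using model that by (simp add: statistical_model_def)
        have "f \<in> borel_measurable (P \<theta>')" "integrable (P \<theta>') (\<lambda>x. (f x)\<^sup>2)"
          using that by (auto simp: finite_second_moment_def)
        then show ?thesis
          by (rule square_integrable_imp_integrable)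
      qed
      have U: "zero_estimator M P \<Theta> (\<lambda>x. h x + (-1) * g x)"
        unfolding zero_estimator_def
      proof (intro conjI ballI)
        show "(\<lambda>x. h x + (-1) * g x) \<in> borel_measurable M"
          using h(1) g(1) by measurable
        show "finite_second_moment P \<Theta> (\<lambda>x. h x + (-1) * g x)"
          using model h(1) g(1) h(2) g(2) by (rule finite_second_moment_add_cmult)
        fix \<theta>' assume "\<theta>' \<in> \<Theta>"
        then show "prob_space.expectation (P \<theta>') (\<lambda>x. h x + (-1) * g x) = 0"
          using int[OF h] int[OF g] mean by simp
      qed
      then have "(LINT x|P \<theta>. g x * (h x + (-1) * g x)) = 0"
        using orth \<theta> by blast
      then show "prob_space.variance (P \<theta>) g \<le> prob_space.variance (P \<theta>) h"
        using line(2)[OF U \<theta>, of 1] by simp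
    qed
  qed
qed

section \<open>Sets of MVE-algebras acting on unbiased estimators of zero\<close>

text \<open>Multiplying by the indicator keeps measurability and the second moment; that the mean stays
  zero is the orthogonality of \<open>U\<close> to the UMVUE \<open>indicator A\<close>.\<close>

lemma MVE_algebra_indicator_mult:
  assumes model: "statistical_model M P \<Theta>" and F: "MVE_algebra M P \<Theta> F"
    and A: "A \<in> sets F" and U: "zero_estimator M P \<Theta> U"
  shows "zero_estimator M P \<Theta> (\<lambda>x. indicator A x * U x)"
proof -
  have AM: "A \<in> sets M"
    using F A by (auto simp: MVE_algebra_def subalgebra_def)
  have "integrable (P \<theta>) (\<lambda>x. \<bar>indicator A x :: real\<bar>\<^sup>2)"
    and "integrable (P \<theta>) (\<lambda>x. \<bar>indicator A x * U x\<bar>\<^sup>2)" if "\<theta> \<in> \<Theta>" for \<theta>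
  proof -
    interpret prob_space "P \<theta>"
      using model that by (simp add: statistical_model_def)
    have A_events: "A \<in> sets (P \<theta>)"
      using model that AM by (simp add: statistical_model_def)
    have square: "(\<lambda>x. \<bar>indicator A x :: real\<bar>\<^sup>2) = indicator A"
      by (auto simp: indicator_def)
    show "integrable (P \<theta>) (\<lambda>x. \<bar>indicator A x :: real\<bar>\<^sup>2)"
      unfolding square using A_events by (simp add: integrable_indicator_iff emeasure_eq_measure)
    have "integrable (P \<theta>) (\<lambda>x. indicator A x *\<^sub>R \<bar>U x\<bar>\<^sup>2)"
      using A_events U that
      by (intro integrable_mult_indicator) (auto simp: zero_estimator_def finite_second_moment_def)
    moreover have "\<bar>indicator A x * U x\<bar>\<^sup>2 = indicator A x *\<^sub>R \<bar>U x\<bar>\<^sup>2" for x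
      by (simp add: indicator_def)
    ultimately show "integrable (P \<theta>) (\<lambda>x. \<bar>indicator A x * U x\<bar>\<^sup>2)"
      by simp
  qed
  then have fsm: "finite_second_moment P \<Theta> (indicator A)"
      "finite_second_moment P \<Theta> (\<lambda>x. indicator A x * U x)"
    by (simp_all add: finite_second_moment_def)
  have "UMVUE M P \<Theta> (indicator A)"
    using F A fsm(1) by (simp add: MVE_algebra_def)
  then have "\<forall>\<theta>\<in>\<Theta>. (LINT x|P \<theta>. indicator A x * U x) = 0"
    using UMVUE_iff_orthogonal[OF model _ fsm(1)] AM U by simp
  moreover have "(\<lambda>x. indicator A x * U x) \<in> borel_measurable M"
    using AM U by (auto simp: zero_estimator_def)
  ultimately show ?thesis
    using fsm(2) by (simp add: zero_estimator_def)
qed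

text \<open>The sets on which \<open>U\<close> integrates to zero form a Dynkin system.\<close>

lemma set_integral_eq_zero_sigma_sets:
  fixes U :: "'a \<Rightarrow> real"
  assumes int: "integrable N U" and "Int_stable G" and G: "G \<subseteq> sets N"
    and zero: "\<And>A. A \<in> G \<Longrightarrow> (LINT x:A|N. U x) = 0" and total: "(LINT x|N. U x) = 0"
    and C: "C \<in> sigma_sets (space N) G"
  shows "(LINT x:C|N. U x) = 0"
proof -
  have sub: "sigma_sets (space N) G \<subseteq> sets N"
    using G by (rule sets.sigma_sets_subset)
  have set_int: "set_integrable N A U" if "A \<in> sets N" for A
    unfolding set_integrable_def using that int by (rule integrable_mult_indicator)
  have space: "(LINT x:space N|N. U x) = 0"
    using total set_integral_space[OF int] by simp
  have "G \<subseteq> Pow (space N)"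
    using G sets.space_closed by blast
  with \<open>Int_stable G\<close> show ?thesis
    using C
  proof (induction rule: sigma_sets_induct_disjoint)
    case (basic A)
    then show ?case by (rule zero)
  next
    case empty
    then show ?case by (simp add: set_lebesgue_integral_def)
  next
    case (compl A)
    have A: "A \<in> sets N"
      using compl sub by blast
    then have "A \<union> (space N - A) = space N"
      using sets.sets_into_space by blast
    then have "(LINT x:A|N. U x) + (LINT x:space N - A|N. U x) = (LINT x:space N|N. U x)"
      using A set_integral_Un[of A "space N - A" N U] set_int by (simp add: Int_Diff)
    then show ?case
      using compl space by simp
  next
    case (union A)
    have "A i \<in> sets N" for i
      using union sub by blast
    moreover have "A i \<inter> A j = {}" if "i \<noteq> j" for i j
      using union that by (auto simp: disjoint_family_on_def)
    ultimately have "(LINT x:(\<Union>i. A i)|N. U x) = (\<Sum>i. LINT x:A i|N. U x)"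
      by (intro lebesgue_integral_countable_add set_int) auto
    then show ?case
      using union by simp
  qed
qed

text \<open>The hypothesis on the sets of \<open>F\<close> says that the conditional expectation of \<open>U\<close>
  given \<open>F\<close> is zero, and \<open>g\<close> may be pulled out of a conditional expectation.\<close>

lemma (in prob_space) orthogonal_if_set_integrals_zero:
  fixes g U :: "'a \<Rightarrow> real"
  assumes F: "subalgebra M F" and g: "g \<in> borel_measurable F"
    and int: "integrable M U" "integrable M (\<lambda>x. g x * U x)"
    and zero: "\<And>C. C \<in> sets F \<Longrightarrow> (LINT x:C|M. U x) = 0"
  shows "(LINT x|M. g x * U x) = 0"
proof -
  interpret finite_measure_subalgebra M F
    by standard (rule F)
  have "AE x in M. real_cond_exp M F U x = 0"
    using zero int by (intro real_cond_exp_charact) (auto simp: set_lebesgue_integral_def)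
  then have "(LINT x|M. g x * real_cond_exp M F U x) = 0"
    by (intro integral_eq_zero_AE) auto
  then show ?thesis
    using real_cond_exp_intg(2)[OF int(2) g] int(1) by simp
qed

section \<open>The join of two MVE-algebras\<close>

theorem theorem1:
  fixes M F1 F2 :: "'a measure" and P :: "'t \<Rightarrow> 'a measure" and \<Theta> :: "'t set"
  assumes "statistical_model M P \<Theta>"
    and "MVE_algebra M P \<Theta> F1"
    and "MVE_algebra M P \<Theta> F2"
  shows "MVE_algebra M P \<Theta> (sigma (space M) (sets F1 \<union> sets F2))"
proof -
  let ?F = "sigma (space M) (sets F1 \<union> sets F2)"
  let ?G = "{A \<inter> B | A B. A \<in> sets F1 \<and> B \<in> sets F2}"
  note model = assms(1)
  have F1: "space F1 = space M" "sets F1 \<subseteq> sets M" and F2: "space F2 = space M" "sets F2 \<subseteq> sets M"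
    using assms by (auto simp: MVE_algebra_def subalgebra_def)
  have sub_Pow: "sets F1 \<union> sets F2 \<subseteq> Pow (space M)"
    using F1 F2 sets.space_closed[of M] by blast
  have sets_F: "sets ?F = sigma_sets (space M) (sets F1 \<union> sets F2)"
    using sub_Pow by simp
  have subalg: "subalgebra M ?F"
    unfolding subalgebra_def sets_F using F1 F2 sub_Pow
    by (simp add: sets.sigma_sets_subset space_measure_of)
  have G_sub: "?G \<subseteq> sets M"
    using F1 F2 by blast
  have Int_stable_G: "Int_stable ?G"
  proof (rule Int_stableI)
    fix a b assume "a \<in> ?G" "b \<in> ?G"
    then obtain A B A' B' where *: "a = A \<inter> B" "b = A' \<inter> B'"
        "A \<in> sets F1" "B \<in> sets F2" "A' \<in> sets F1" "B' \<in> sets F2"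
      by blast
    then have "a \<inter> b = (A \<inter> A') \<inter> (B \<inter> B')" "A \<inter> A' \<in> sets F1" "B \<inter> B' \<in> sets F2"
      by auto
    then show "a \<inter> b \<in> ?G" by blast
  qed
  have generate: "sets ?F \<subseteq> sigma_sets (space M) ?G"
    unfolding sets_F
  proof (rule sigma_sets_mono, rule subsetI)
    fix A assume A: "A \<in> sets F1 \<union> sets F2"
    then have "A = A \<inter> space M" "A = space M \<inter> A"
      using sub_Pow by auto
    \<comment> \<open>Each algebra contains the whole space, so \<open>A\<close> is one of the intersections.\<close>
    moreover have "space M \<in> sets F1" "space M \<in> sets F2"
      using F1 F2 sets.top[of F1] sets.top[of F2] by auto
    ultimately have "A \<in> ?G"
      using A by blast
    then show "A \<in> sigma_sets (space M) ?G" ..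
  qed
  have "UMVUE M P \<Theta> g" if g: "g \<in> borel_measurable ?F" and fsm: "finite_second_moment P \<Theta> g" for g
  proof -
    have gM: "g \<in> borel_measurable M"
      using measurable_from_subalg[OF subalg g] .
    have "(LINT x|P \<theta>. g x * U x) = 0" if U: "zero_estimator M P \<Theta> U" and \<theta>: "\<theta> \<in> \<Theta>" for U \<theta>
    proof -
      interpret prob_space "P \<theta>"
        using model \<theta> by (simp add: statistical_model_def)
      have sets_P: "sets (P \<theta>) = sets M"
        using model \<theta> by (simp add: statistical_model_def)
      note [measurable_cong] = sets_P
      have space_P: "space (P \<theta>) = space M"
        using sets_P by (rule sets_eq_imp_space_eq)
      have meas: "g \<in> borel_measurable (P \<theta>)" "U \<in> borel_measurable (P \<theta>)"
        and sq: "integrable (P \<theta>) (\<lambda>x. (g x)\<^sup>2)" "integrable (P \<theta>) (\<lambda>x. (U x)\<^sup>2)"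
        using gM U fsm \<theta> by (auto simp: zero_estimator_def finite_second_moment_def)
      have int: "integrable (P \<theta>) U" "integrable (P \<theta>) (\<lambda>x. g x * U x)"
        using square_integrable_imp_integrable[OF meas(2) sq(2)]
          integrable_mult_of_squares[OF meas sq] by auto
      have inter: "(LINT x:C|P \<theta>. U x) = 0" if C_G: "C \<in> ?G" for C
      proof -
        obtain A B where C: "C = A \<inter> B" and AB: "A \<in> sets F1" "B \<in> sets F2"
          using C_G by blast
        \<comment> \<open>The inner product is an unbiased estimator of zero for all parameters at once, which
          is what licenses the second multiplication.\<close>
        have "zero_estimator M P \<Theta> (\<lambda>x. indicator B x * (indicator A x * U x))"
          using U AB by (intro MVE_algebra_indicator_mult[OF model assms(3)]
              MVE_algebra_indicator_mult[OF model assms(2)])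
        then have "(LINT x|P \<theta>. indicator B x * (indicator A x * U x)) = 0"
          using \<theta> by (simp add: zero_estimator_def)
        then show ?thesis
          by (simp add: C set_lebesgue_integral_def indicator_inter_arith mult_ac)
      qed
      have total: "expectation U = 0"
        using U \<theta> by (simp add: zero_estimator_def)
      show ?thesis
      proof (rule orthogonal_if_set_integrals_zero[OF _ g int])
        show "subalgebra (P \<theta>) ?F"
          using subalg by (simp add: subalgebra_def sets_P space_P)
        fix C assume "C \<in> sets ?F"
        then have "C \<in> sigma_sets (space (P \<theta>)) ?G"
          unfolding space_P using generate by (rule rev_subsetD)
        moreover have "?G \<subseteq> sets (P \<theta>)"
          unfolding sets_P by (rule G_sub)
        ultimately show "(LINT x:C|P \<theta>. U x) = 0"
          using set_integral_eq_zero_sigma_sets[OF int(1) Int_stable_G _ inter total] by blast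
      qed
    qed
    then show ?thesis
      using UMVUE_iff_orthogonal[OF model gM fsm] by blast
  qed
  then show ?thesis
    using subalg by (simp add: MVE_algebra_def)
qed

end
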